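(* For any set $E\subset\mathbb{R}^{N+1}$, $$\widetilde\gamma_{\Theta,+}^{1/2}(E)\approx\sup\big\{\mu(E)\,:\,\operatorname{supp}\mu\subset E,\ \|T_\mu\|_{L^2(\mu)\to L^2(\mu)}\le1\big\},$$ where the supremum is over positive measures $\mu$ and the implicit constant in the estimate is independent of $E$.
   Context: Points of $\mathbb{R}^{N+1}$ are $\bar x=(x,t)$, $x\in\mathbb{R}^N$, $t\in\mathbb{R}$. The notation $A\approx B$ means that $C^{-1}B\le A\le CB$ for some constant $C\ge1$. $P$ is the fundamental solution of the $\frac12$-fractional heat equation $(-\Delta_x)^{1/2}f+\partial_tf=0$, that is (up to a normalizing constant) $P(x,t)=\frac{t}{(t^2+|x|^2)^{(N+1)/2}}$ for $t>0$ and $P(x,t)=0$ for $t\le0$. For a measure $\mu$, $T\mu(\bar x)=\int P(\bar x-\bar y)\,d\mu(\bar y)$ and $T^*\mu(\bar x)=\int P(\bar y-\bar x)\,d\mu(\bar y)$. For $\varepsilon>0$, $T_\varepsilon\mu(\bar x)=\int_{|\bar x-\bar y|>\varepsilon}P(\bar x-\bar y)\,d\mu(\bar y)$ whenever the integral makes sense, and for $f\in L^1_{loc}(\mu)$, $T_\mu f=T(f\mu)$ and $T_{\mu,\varepsilon}f=T_\varepsilon(f\mu)$. $T_\mu$ is said to be bounded in $L^2(\mu)$ if the operators $T_{\mu,\varepsilon}$ are bounded in $L^2(\mu)$ uniformly on $\varepsilon>0$; accordingly $\|T_\mu\|_{L^2(\mu)\to L^2(\mu)}\le1$ means $\|T_{\mu,\varepsilon}\|_{L^2(\mu)\to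 L^2(\mu)}\le1$ for all $\varepsilon>0$. The capacity is $\widetilde\gamma_{\Theta,+}^{1/2}(E)=\sup\mu(E)$, the supremum being over all positive measures $\mu$ supported on $E$ such that $\|T\mu\|_{L^\infty(\mathbb{R}^{N+1})}\le1$ and $\|T^*\mu\|_{L^\infty(\mathbb{R}^{N+1})}\le1$.
   Formalization: The supremum on the right is taken only over positive measures that also satisfy μ(B(x,r)) ≤ r^N for all balls; without this it is infinite for every nonempty E (take large multiples of a point mass), while the capacity of a point is 0. *)

theory Defs
  imports "HOL-Analysis.Analysis" "HOL-Probability.Essential_Supremum"
begin

text \<open>Points \<open>(x, t)\<close> of \<open>R^(N+1)\<close>, with \<open>N = CARD('n)\<close>. The norm of the product type is
  the Euclidean one.\<close>

type_synonym 'n spacetime = "(real ^ 'n) \<times> real"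

definition P :: "'n::finite spacetime \<Rightarrow> real" where
  "P = (\<lambda>(x, t). if t > 0
          then t / (t\<^sup>2 + (norm x)\<^sup>2) powr ((real CARD('n) + 1) / 2)
          else 0)"

definition T :: "'n::finite spacetime measure \<Rightarrow> 'n spacetime \<Rightarrow> ennreal" where
  "T \<mu> x = (\<integral>\<^sup>+ y. ennreal (P (x - y)) \<partial>\<mu>)"

definition T_adj :: "'n::finite spacetime measure \<Rightarrow> 'n spacetime \<Rightarrow> ennreal" where
  "T_adj \<mu> x = (\<integral>\<^sup>+ y. ennreal (P (y - x)) \<partial>\<mu>)"

text \<open>The truncated operator \<open>f \<mapsto> T_\<epsilon>(f \<mu>)\<close>. The Bochner integral is 0 where the integrand
  is not integrable, so the existence of the integral is a separate condition.\<close>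

definition trunc_ok ::
  "'n::finite spacetime measure \<Rightarrow> real \<Rightarrow> ('n spacetime \<Rightarrow> real) \<Rightarrow> 'n spacetime \<Rightarrow> bool" where
  "trunc_ok \<mu> \<epsilon> f x \<longleftrightarrow> set_integrable \<mu> {y. norm (x - y) > \<epsilon>} (\<lambda>y. P (x - y) * f y)"

definition T_trunc ::
  "'n::finite spacetime measure \<Rightarrow> real \<Rightarrow> ('n spacetime \<Rightarrow> real) \<Rightarrow> 'n spacetime \<Rightarrow> real" where
  "T_trunc \<mu> \<epsilon> f x = (LINT y:{y. norm (x - y) > \<epsilon>}|\<mu>. P (x - y) * f y)"

definition L2 :: "'a measure \<Rightarrow> ('a \<Rightarrow> real) set" where
  "L2 \<mu> = {f \<in> borel_measurable \<mu>. integrable \<mu> (\<lambda>x. (f x)\<^sup>2)}"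

definition L2_norm :: "'a measure \<Rightarrow> ('a \<Rightarrow> real) \<Rightarrow> real" where
  "L2_norm \<mu> f = sqrt (\<integral>x. (f x)\<^sup>2 \<partial>\<mu>)"

text \<open>The norm of \<open>T_\<mu>\<close> on \<open>L\<^sup>2(\<mu>)\<close> is at most \<open>c\<close>, i.e. this holds for every truncation.\<close>

definition T_L2_bound :: "'n::finite spacetime measure \<Rightarrow> real \<Rightarrow> bool" where
  "T_L2_bound \<mu> c \<longleftrightarrow>
     (\<forall>\<epsilon>>0. \<forall>f\<in>L2 \<mu>. (AE x in \<mu>. trunc_ok \<mu> \<epsilon> f x) \<and>
        T_trunc \<mu> \<epsilon> f \<in> L2 \<mu> \<and> L2_norm \<mu> (T_trunc \<mu> \<epsilon> f) \<le> c * L2_norm \<mu> f)"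

definition radon_measure :: "'a::topological_space measure \<Rightarrow> bool" where
  "radon_measure \<mu> \<longleftrightarrow> sets \<mu> = sets borel \<and> (\<forall>K. compact K \<longrightarrow> emeasure \<mu> K < \<infinity>)"

definition msupp :: "'a::topological_space measure \<Rightarrow> 'a set" where
  "msupp \<mu> = {x. \<forall>U. open U \<and> x \<in> U \<longrightarrow> emeasure \<mu> U > 0}"

definition has_growth :: "'n::finite spacetime measure \<Rightarrow> bool" where
  "has_growth \<mu> \<longleftrightarrow> (\<forall>x r. r > 0 \<longrightarrow> emeasure \<mu> (ball x r) \<le> ennreal (r ^ CARD('n)))"

text \<open>\<open>\<mu>(E)\<close> is written with \<^const>\<open>outer_measure_of\<close> because \<open>E\<close> need not be a Borel set, and
  \<^const>\<open>emeasure\<close> is 0 outside the sigma-algebra. If \<open>msupp \<mu> \<subseteq> E\<close>, then \<open>E\<close> differs from the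
  closed set \<open>msupp \<mu>\<close> by a null set.\<close>

definition capacity_plus :: "'n::finite spacetime set \<Rightarrow> ennreal" where
  "capacity_plus E = Sup {outer_measure_of \<mu> E | \<mu>. radon_measure \<mu> \<and> msupp \<mu> \<subseteq> E \<and>
     esssup lborel (T \<mu>) \<le> 1 \<and> esssup lborel (T_adj \<mu>) \<le> 1}"

text \<open>The supremum of \<open>\<mu>(E)\<close> over the measures of \<open>N\<close>-growth (with constant 1) on \<open>E\<close> for which
  \<open>T_\<mu>\<close> has norm at most 1. The growth condition has to be imposed: the \<open>L\<^sup>2\<close> condition does not
  see measures \<open>\<mu>\<close> on a horizontal hyperplane \<open>{t = const}\<close>, nor point masses, since \<open>P\<close>
  vanishes at all differences of points in their supports.\<close>

definition capacity_L2 :: "'n::finite spacetime set \<Rightarrow> ennreal" where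
  "capacity_L2 E = Sup {outer_measure_of \<mu> E | \<mu>. radon_measure \<mu> \<and> msupp \<mu> \<subseteq> E \<and>
     has_growth \<mu> \<and> T_L2_bound \<mu> 1}"

end

theory Submission
  imports Defs
begin

text \<open>Both inequalities rest on the positivity of the kernel \<open>P\<close>, which replaces the theory of singular
integrals by elementary comparison and integration arguments.

Suppose first that \<open>T \<mu> \<le> 1\<close> and \<open>T* \<mu> \<le> 1\<close> almost everywhere. Looking at a ball from a point
somewhat later in time shows that \<open>\<mu>\<close> has \<open>N\<close>-growth (\<open>growth_of_AE_potential_le\<close>). A one-sided Harnack
inequality in time bounds the truncated potential at any point by the full potential at nearby
later points, among which there is one where the a.e. bound holds
(\<open>trunc_potential_le_of_AE\<close>). Hence all truncations of \<open>T \<mu>\<close> and \<open>T* \<mu>\<close> are bounded everywhere, and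
the Schur test (\<open>Schur_test_nn\<close>) gives the \<open>L\<^sup>2\<close> bound for a fixed multiple of \<open>\<mu>\<close>.

Suppose conversely that \<open>\<mu>\<close> has growth and that \<open>T_\<mu>\<close> has norm at most 1. Testing the operator on the
indicator of a compact set \<open>K\<close> and letting the truncation parameter tend to zero bounds the integral of
\<open>T(\<mu>|\<^sub>K)\<close> against \<open>\<mu>|\<^sub>K\<close> by \<open>\<mu> K\<close> (\<open>energy_le_of_T_L2_bound\<close>). As the kernel is positive, this is an
\<open>L\<^sup>1\<close> bound, for the adjoint as well by Tonelli, and the Markov inequality provides a set carrying at least
half of the mass on which both potentials are at most 4 (\<open>half_mass_bounded_potentials\<close>). Restricting
the measure to this set only decreases the potentials. Finally the growth condition yields a maximum
principle (\<open>maximum_principle\<close>): bounds on a carrier of the measure extend to the whole space.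
A multiple of the restricted measure is therefore admissible for \<open>capacity_plus\<close>, and exhausting the
space by compact balls \<open>K\<close> concludes.\<close>

section \<open>The kernel\<close>

text \<open>In this form \<open>P\<close> is visibly homogeneous of degree \<open>-N\<close>, and the value at the origin is \<open>0 / 0 = 0\<close>.\<close>

lemma P_eq:
  fixes z :: "'n::finite spacetime"
  shows "P z = max 0 (snd z) / norm z ^ (CARD('n) + 1)"
proof (cases z)
  case (Pair x t)
  have "norm z ^ (CARD('n) + 1) = (t\<^sup>2 + (norm x)\<^sup>2) powr ((real CARD('n) + 1) / 2)" if "t > 0"
  proof -
    have "0 < norm z" using that Pair by (auto simp: zero_prod_def)
    moreover have "t\<^sup>2 + (norm x)\<^sup>2 = norm z powr 2"
      using \<open>0 < norm z\<close> by (simp add: Pair norm_Pair powr_numeral add.commute)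
    moreover have "2 * ((real CARD('n) + 1) / 2) = real (CARD('n) + 1)"
      by simp
    ultimately show ?thesis
      by (simp only: powr_powr powr_realpow)
  qed
  then show ?thesis by (auto simp: P_def Pair)
qed

lemma P_nonneg [simp]: "0 \<le> P z"
  by (simp add: P_eq)

lemma P_zero [simp]: "P 0 = 0"
  by (simp add: P_eq)

lemma P_measurable [measurable]: "(P :: 'n::finite spacetime \<Rightarrow> real) \<in> borel_measurable borel"
proof -
  have "P = (\<lambda>z :: 'n spacetime. max 0 (snd z) / norm z ^ (CARD('n) + 1))"
    by (simp add: P_eq fun_eq_iff)
  moreover have "(\<lambda>z :: 'n spacetime. snd z) \<in> borel_measurable borel"
    by (intro borel_measurable_continuous_onI continuous_intros)
  ultimately show ?thesis
    by (elim ssubst) (intro borel_measurable_divide borel_measurable_max borel_measurable_power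
      borel_measurable_norm, auto)
qed

lemma abs_snd_le_norm: "\<bar>snd z\<bar> \<le> norm z" for z :: "'a::real_normed_vector \<times> real"
  using norm_snd_le[of "snd z" "fst z"] by simp

lemma P_le:
  fixes z :: "'n::finite spacetime"
  shows "P z \<le> 1 / norm z ^ CARD('n)"
proof (cases "z = 0")
  case False
  have "snd z \<le> norm z" using abs_snd_le_norm[of z] by simp
  then have "P z \<le> norm z / norm z ^ (CARD('n) + 1)"
    unfolding P_eq by (intro divide_right_mono) auto
  then show ?thesis using False by simp
qed simp

text \<open>A one-sided Harnack inequality. A displacement by at most the distance to the pole at most doubles
that distance, and it cannot decrease the numerator of the kernel if it does not go back in time.\<close>

lemma P_le_P_upward:
  fixes z w :: "'n::finite spacetime"
  assumes "0 \<le> snd w" "norm w \<le> norm z"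
  shows "P z \<le> 2 ^ (CARD('n) + 1) * P (z + w)"
proof (cases "snd z > 0")
  case True
  have "z + w \<noteq> 0" using True assms by (auto simp: prod_eq_iff)
  have "norm (z + w) \<le> 2 * norm z" using norm_triangle_ineq[of z w] assms by simp
  then have "norm (z + w) ^ (CARD('n) + 1) \<le> 2 ^ (CARD('n) + 1) * norm z ^ (CARD('n) + 1)"
    by (metis norm_ge_zero power_mono power_mult_distrib)
  moreover have "z \<noteq> 0" using True by auto
  ultimately have "snd z * norm (z + w) ^ (CARD('n) + 1)
      \<le> snd (z + w) * (2 ^ (CARD('n) + 1) * norm z ^ (CARD('n) + 1))"
    using True assms by (intro mult_mono) auto
  then show ?thesis
    using True assms \<open>z \<noteq> 0\<close> \<open>z + w \<noteq> 0\<close> by (simp add: P_eq field_simps)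
qed (simp add: P_eq)

text \<open>The substitute for the Harnack inequality when the displacement has no preferred direction. Since
the numerator \<open>max 0 t\<close> is 1-Lipschitz, an arbitrary displacement costs, besides the factor, one
additive error of the order of the modulus of continuity of a Calderon-Zygmund kernel. The growth
of a measure makes this error integrable away from the pole.\<close>

lemma P_le_P_nearby:
  fixes z w :: "'n::finite spacetime"
  assumes "norm (z - w) \<le> norm z"
  shows "P z \<le> 2 ^ (CARD('n) + 1) * P w + norm (z - w) / norm z ^ (CARD('n) + 1)"
proof (cases "z = 0")
  case False
  let ?N = "CARD('n) + 1"
  have "max 0 (snd z) \<le> max 0 (snd w) + norm (z - w)"
    using abs_snd_le_norm[of "z - w"] by auto
  then have "P z \<le> (max 0 (snd w) + norm (z - w)) / norm z ^ ?N"
    unfolding P_eq by (intro divide_right_mono) auto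
  moreover have "max 0 (snd w) / norm z ^ ?N \<le> 2 ^ ?N * P w"
  proof (cases "w = 0")
    case False
    have "norm w \<le> 2 * norm z" using norm_triangle_ineq2[of w z] assms by (simp add: norm_minus_commute)
    then have "norm w ^ ?N \<le> 2 ^ ?N * norm z ^ ?N"
      by (metis norm_ge_zero power_mono power_mult_distrib)
    then have "max 0 (snd w) * norm w ^ ?N \<le> max 0 (snd w) * (2 ^ ?N * norm z ^ ?N)"
      by (intro mult_left_mono) auto
    then show ?thesis using False \<open>z \<noteq> 0\<close> by (simp add: P_eq field_simps)
  qed simp
  ultimately show ?thesis by (simp add: add_divide_distrib)
qed simp

section \<open>Truncated potentials\<close>

text \<open>The parameter \<open>s\<close> is \<open>1\<close> for the operator and \<open>-1\<close> for its adjoint, so that both are treated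
by the same lemmas. Since \<open>P 0 = 0\<close>, the truncation at \<open>e = 0\<close> gives the full kernel.\<close>

definition kernel :: "real \<Rightarrow> real \<Rightarrow> 'n::finite spacetime \<Rightarrow> 'n spacetime \<Rightarrow> real" where
  "kernel s e x y = (if e < norm (x - y) then P (s *\<^sub>R (x - y)) else 0)"

definition potential :: "real \<Rightarrow> real \<Rightarrow> 'n::finite spacetime measure \<Rightarrow> 'n spacetime \<Rightarrow> ennreal" where
  "potential s e \<mu> x = (\<integral>\<^sup>+ y. ennreal (kernel s e x y) \<partial>\<mu>)"

lemma kernel_nonneg [simp]: "0 \<le> kernel s e x y"
  by (simp add: kernel_def)

lemma kernel_swap: "kernel s e x y = kernel (- s) e y x"
  by (simp add: kernel_def norm_minus_commute algebra_simps)

lemma kernel_0: "kernel s 0 x y = P (s *\<^sub>R (x - y))"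
  by (simp add: kernel_def)

lemma T_eq_potential: "T \<mu> = potential 1 0 \<mu>"
  by (simp add: fun_eq_iff T_def potential_def kernel_0)

lemma T_adj_eq_potential: "T_adj \<mu> = potential (- 1) 0 \<mu>"
  by (simp add: fun_eq_iff T_adj_def potential_def kernel_0)

lemma kernel_measurable [measurable]:
  "(\<lambda>p. kernel s e (fst p) (snd p)) \<in> borel_measurable (borel \<Otimes>\<^sub>M borel)"
  unfolding kernel_def by measurable

lemma kernel_measurable_compose [measurable]:
  "f \<in> borel_measurable M \<Longrightarrow> g \<in> borel_measurable M \<Longrightarrow>
    (\<lambda>w. kernel s e (f w) (g w)) \<in> borel_measurable M"
  using measurable_compose[OF measurable_Pair kernel_measurable, of f M g s e] by simp

lemma sets_borel_id:
  "sets \<mu> = sets borel \<Longrightarrow> (\<lambda>x. x) \<in> borel_measurable \<mu>"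
  by (simp cong: measurable_cong_sets)

lemma potential_measurable:
  assumes "sigma_finite_measure \<mu>" "sets \<mu> = sets borel"
  shows "potential s e \<mu> \<in> borel_measurable borel"
proof -
  interpret sigma_finite_measure \<mu> by fact
  note sets_borel_id[OF assms(2), measurable]
  show ?thesis unfolding potential_def[abs_def] by measurable
qed

text \<open>Monotone convergence. The only point that no positive truncation sees is the pole, where the kernel
is zero.\<close>

lemma potential_eq_SUP:
  fixes \<mu> :: "'n::finite spacetime measure"
  assumes sets: "sets \<mu> = sets borel"
  shows "potential s 0 \<mu> x = (SUP n. potential s (1 / Suc n) \<mu> x)"
proof -
  note sets_borel_id[OF sets, measurable]
  have inc: "incseq (\<lambda>n y. ennreal (kernel s (1 / Suc n) x y))"
  proof (intro incseq_SucI le_funI ennreal_leI)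
    fix n y
    have "1 / real (Suc (Suc n)) \<le> 1 / real (Suc n)" by (simp add: field_simps)
    then show "kernel s (1 / Suc n) x y \<le> kernel s (1 / Suc (Suc n)) x y"
      unfolding kernel_def by (auto simp del: of_nat_Suc)
  qed
  have "ennreal (kernel s 0 x y) = (SUP n. ennreal (kernel s (1 / Suc n) x y))" for y
  proof (rule antisym)
    show "ennreal (kernel s 0 x y) \<le> (SUP n. ennreal (kernel s (1 / Suc n) x y))"
    proof (cases "x = y")
      case False
      then obtain n where "1 / real (Suc n) < norm (x - y)"
        using nat_approx_posE[of "norm (x - y)"] by auto
      then have "kernel s 0 x y = kernel s (1 / Suc n) x y"
        using False by (auto simp: kernel_def)
      then show ?thesis by (intro SUP_upper2[of n]) auto
    qed (simp add: kernel_def)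
  qed (auto intro!: SUP_least ennreal_leI simp: kernel_def)
  then show ?thesis
    unfolding potential_def using inc by (simp add: nn_integral_monotone_convergence_SUP)
qed

lemma potential_antimono:
  assumes "e \<le> e'" shows "potential s e' \<mu> x \<le> potential s e \<mu> x"
  unfolding potential_def using assms by (intro nn_integral_mono ennreal_leI) (auto simp: kernel_def)

section \<open>Radon measures, supports and densities\<close>

lemma radon_sigma_finite:
  fixes \<mu> :: "'a::{heine_borel, real_normed_vector} measure"
  assumes "radon_measure \<mu>"
  shows "sigma_finite_measure \<mu>"
proof
  have "(\<Union>n. cball 0 (real n)) = (UNIV :: 'a set)"
    by (auto intro: real_arch_simple)
  moreover have "space \<mu> = UNIV"
    using assms sets_eq_imp_space_eq[of \<mu> borel] by (simp add: radon_measure_def)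
  ultimately show "\<exists>A. countable A \<and> A \<subseteq> sets \<mu> \<and> \<Union> A = space \<mu> \<and> (\<forall>a\<in>A. emeasure \<mu> a \<noteq> \<infinity>)"
    using assms by (intro exI[of _ "range (\<lambda>n. cball 0 (real n))"]) (auto simp: radon_measure_def less_top)
qed

text \<open>The complement of the support is a union of open null sets, and by the Lindelof property
countably many of them suffice.\<close>

lemma outer_measure_of_msupp:
  fixes \<mu> :: "'a::second_countable_topology measure"
  assumes sets: "sets \<mu> = sets borel" and "msupp \<mu> \<subseteq> E"
  shows "outer_measure_of \<mu> E = emeasure \<mu> UNIV"
proof -
  have sp: "space \<mu> = UNIV" using sets_eq_imp_space_eq[OF sets] by simp
  define \<U> where "\<U> = {U. open U \<and> emeasure \<mu> U = 0}"
  obtain \<V> where V: "\<V> \<subseteq> \<U>" "countable \<V>" "\<Union>\<V> = \<Union>\<U>"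
    using Lindelof[of \<U>] by (auto simp: \<U>_def)
  have null: "\<Union>\<U> \<in> null_sets \<mu>"
    unfolding V(3)[symmetric]
    using V sets by (intro null_sets_UN'[of \<V> id, simplified]) (auto simp: \<U>_def null_sets_def)
  have comp: "- msupp \<mu> \<subseteq> \<Union>\<U>"
    by (auto simp: msupp_def \<U>_def not_less)
  have "emeasure \<mu> UNIV \<le> emeasure \<mu> B" if "B \<in> sets \<mu>" "E \<subseteq> B" for B
  proof -
    have "emeasure \<mu> UNIV = emeasure \<mu> (B \<union> \<Union>\<U>)"
      using that assms(2) comp by (intro arg_cong[where f = "emeasure \<mu>"]) auto
    also have "\<dots> = emeasure \<mu> B"
      using emeasure_Un_null_set[OF that(1) null] .
    finally show ?thesis by simp
  qed
  then show ?thesis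
    unfolding outer_measure_of_def sp[symmetric] using sp sets.top[of \<mu>]
    by (intro antisym INF_greatest INF_lower2[of "space \<mu>"]) auto
qed

lemma emeasure_density_le:
  assumes g: "g \<in> borel_measurable \<mu>" and le: "\<And>x. g x \<le> 1"
  shows "emeasure (density \<mu> g) A \<le> emeasure \<mu> A"
proof (cases "A \<in> sets \<mu>")
  case True
  have "emeasure (density \<mu> g) A = (\<integral>\<^sup>+ x. g x * indicator A x \<partial>\<mu>)"
    by (rule emeasure_density) (use g True in auto)
  also have "\<dots> \<le> (\<integral>\<^sup>+ x. indicator A x \<partial>\<mu>)"
    using le by (intro nn_integral_mono) (auto simp: indicator_def)
  finally show ?thesis using True by simp
qed (simp add: emeasure_notin_sets)

lemma radon_density:
  assumes "radon_measure \<mu>" "g \<in> borel_measurable \<mu>" "\<And>x. g x \<le> 1"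
  shows "radon_measure (density \<mu> g)"
  using assms(1) le_less_trans[OF emeasure_density_le[OF assms(2,3)]]
  unfolding radon_measure_def by simp

lemma has_growth_density:
  fixes \<mu> :: "'n::finite spacetime measure"
  assumes "has_growth \<mu>" "g \<in> borel_measurable \<mu>" "\<And>x. g x \<le> 1"
  shows "has_growth (density \<mu> g)"
  using assms(1) emeasure_density_le[OF assms(2,3)] unfolding has_growth_def by (blast intro: order_trans)

lemma msupp_density:
  assumes "sets \<mu> = sets borel" "g \<in> borel_measurable \<mu>"
  shows "msupp (density \<mu> g) \<subseteq> msupp \<mu>"
proof
  fix x assume x: "x \<in> msupp (density \<mu> g)"
  have "emeasure \<mu> U > 0" if U: "open U" "x \<in> U" for U
  proof (rule ccontr)
    assume "\<not> 0 < emeasure \<mu> U"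
    then have "U \<in> null_sets \<mu>" using U assms(1) by (simp add: null_sets_def)
    then have "U \<in> null_sets (density \<mu> g)"
      using absolutely_continuousI_density[OF assms(2)] by (auto simp: absolutely_continuous_def)
    moreover have "emeasure (density \<mu> g) U > 0" using x U by (auto simp: msupp_def)
    ultimately show False by (simp add: null_sets_def)
  qed
  then show "x \<in> msupp \<mu>" by (auto simp: msupp_def)
qed

lemma potential_density:
  fixes \<mu> :: "'n::finite spacetime measure"
  assumes "sets \<mu> = sets borel" "g \<in> borel_measurable \<mu>"
  shows "potential s e (density \<mu> g) x = (\<integral>\<^sup>+ y. g y * ennreal (kernel s e x y) \<partial>\<mu>)"
proof -
  note sets_borel_id[OF assms(1), measurable]
  show ?thesis unfolding potential_def by (rule nn_integral_density) (use assms in measurable)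
qed

lemma potential_density_const:
  fixes \<mu> :: "'n::finite spacetime measure"
  assumes sets: "sets \<mu> = sets borel"
  shows "potential s e (density \<mu> (\<lambda>_. c)) x = c * potential s e \<mu> x"
proof -
  note sets_borel_id[OF sets, measurable]
  show ?thesis unfolding potential_density[OF sets borel_measurable_const] unfolding potential_def
    by (rule nn_integral_cmult) measurable
qed

lemma potential_density_le:
  fixes \<mu> :: "'n::finite spacetime measure"
  assumes "sets \<mu> = sets borel" "g \<in> borel_measurable \<mu>" "\<And>x. g x \<le> 1"
  shows "potential s e (density \<mu> g) x \<le> potential s e \<mu> x"
proof -
  have "g y * ennreal (kernel s e x y) \<le> 1 * ennreal (kernel s e x y)" for y
    by (intro mult_right_mono assms) simp
  then show ?thesis
    unfolding potential_density[OF assms(1,2)] unfolding potential_def by (intro nn_integral_mono) simp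
qed

section \<open>The maximum principle for measures with growth\<close>

lemma has_growthD:
  fixes \<mu> :: "'n::finite spacetime measure"
  shows "has_growth \<mu> \<Longrightarrow> r > 0 \<Longrightarrow> emeasure \<mu> (ball x r) \<le> ennreal (r ^ CARD('n))"
  unfolding has_growth_def by blast

text \<open>The sum over dyadic shells: on the shell of radius \<open>2\<^sup>k d\<close> the integrand is about
\<open>d / (2\<^sup>k d)\<^sup>N\<^sup>+\<^sup>1\<close>, the measure of the shell is at most about \<open>(2\<^sup>k d)\<^sup>N\<close>, and the product decays like
\<open>1 / 2\<^sup>k\<close>.\<close>

lemma growth_tail_le:
  fixes \<mu> :: "'n::finite spacetime measure"
  assumes sets: "sets \<mu> = sets borel" and growth: "has_growth \<mu>" and d: "d > 0"
  shows "(\<integral>\<^sup>+ y. ennreal (if d < norm (x - y) then d / norm (x - y) ^ (CARD('n) + 1) else 0) \<partial>\<mu>)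
    \<le> ennreal (2 ^ (CARD('n) + 1))"
proof -
  let ?N = "CARD('n)"
  define a where "a k = d / (2 ^ k * d) ^ (?N + 1)" for k :: nat
  define B where "B k = ball x (2 ^ Suc k * d)" for k :: nat
  have a_nonneg: "0 \<le> a k" for k using d by (simp add: a_def)
  have meas: "B k \<in> sets \<mu>" for k by (simp add: sets B_def)
  have pointwise: "ennreal (if d < norm (x - y) then d / norm (x - y) ^ (?N + 1) else 0)
      \<le> (\<Sum>k. ennreal (a k) * indicator (B k) y)" for y
  proof (cases "d < norm (x - y)")
    case True
    let ?w = "norm (x - y)"
    obtain m where "?w / d < 2 ^ m" using real_arch_pow[of 2 "?w / d"] by auto
    then have ex: "\<exists>m. ?w < 2 ^ m * d" using d by (auto simp: field_simps)
    define m where "m = (LEAST m. ?w < 2 ^ m * d)"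
    have m: "?w < 2 ^ m * d" unfolding m_def using ex by (rule LeastI_ex)
    then have "m \<noteq> 0" using True by (intro notI) simp
    then obtain k where k: "m = Suc k" by (cases m) auto
    have "\<not> ?w < 2 ^ k * d" using not_less_Least[of k "\<lambda>m. ?w < 2 ^ m * d"] k m_def by simp
    moreover have "x \<noteq> y" using True d by auto
    ultimately have "d / ?w ^ (?N + 1) \<le> a k"
      unfolding a_def using d by (intro divide_left_mono power_mono mult_pos_pos zero_less_power) auto
    moreover have "y \<in> B k" using m k by (simp add: B_def dist_norm)
    ultimately have "ennreal (if d < ?w then d / ?w ^ (?N + 1) else 0)
        \<le> (\<Sum>k\<in>{k}. ennreal (a k) * indicator (B k) y)"
      using True by (simp add: ennreal_leI)
    also have "\<dots> \<le> (\<Sum>k. ennreal (a k) * indicator (B k) y)"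
      by (intro sum_le_suminf) auto
    finally show ?thesis .
  qed simp
  have shell: "ennreal (a k) * emeasure \<mu> (B k) \<le> ennreal (2 ^ ?N * (1 / 2) ^ k)" for k
  proof -
    have "ennreal (a k) * emeasure \<mu> (B k) \<le> ennreal (a k) * ennreal ((2 ^ Suc k * d) ^ ?N)"
      unfolding B_def using d by (intro mult_left_mono has_growthD[OF growth]) auto
    also have "\<dots> = ennreal (a k * (2 ^ Suc k * d) ^ ?N)"
      using a_nonneg d by (simp add: ennreal_mult)
    also have "a k * (2 ^ Suc k * d) ^ ?N = 2 ^ ?N * (1 / 2) ^ k"
    proof -
      have "(2 ^ Suc k * d) ^ ?N = 2 ^ ?N * (2 ^ k * d) ^ ?N"
        by (simp add: power_mult_distrib)
      then show ?thesis using d by (simp add: a_def power_one_over field_simps)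
    qed
    finally show ?thesis .
  qed
  have "(\<integral>\<^sup>+ y. ennreal (if d < norm (x - y) then d / norm (x - y) ^ (?N + 1) else 0) \<partial>\<mu>)
      \<le> (\<integral>\<^sup>+ y. (\<Sum>k. ennreal (a k) * indicator (B k) y) \<partial>\<mu>)"
    by (intro nn_integral_mono pointwise)
  also have "\<dots> = (\<Sum>k. \<integral>\<^sup>+ y. ennreal (a k) * indicator (B k) y \<partial>\<mu>)"
    using meas by (intro nn_integral_suminf) auto
  also have "\<dots> = (\<Sum>k. ennreal (a k) * emeasure \<mu> (B k))"
    using meas by (simp add: nn_integral_cmult_indicator)
  also have "\<dots> \<le> (\<Sum>k. ennreal (2 ^ ?N * (1 / 2) ^ k))"
    by (intro suminf_le shell) auto
  also have "\<dots> = ennreal (2 ^ ?N * 2)"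
  proof (intro suminf_ennreal_eq sums_mult)
    show "(\<lambda>k. (1 / 2) ^ k) sums (2 :: real)" using geometric_sums[of "1 / 2 :: real"] by simp
  qed simp
  finally show ?thesis by (simp add: mult.commute)
qed

text \<open>The integrated form of \<open>P_le_P_nearby\<close>: the error terms form the tail that is controlled by
\<open>growth_tail_le\<close>.\<close>

lemma trunc_potential_le_nearby:
  fixes \<mu> :: "'n::finite spacetime measure"
  assumes sets: "sets \<mu> = sets borel" and growth: "has_growth \<mu>" and s: "\<bar>s\<bar> = 1"
    and d: "d > 0" "norm (x - z) \<le> d"
  shows "potential s d \<mu> x \<le> ennreal (2 ^ (CARD('n) + 1)) * potential s 0 \<mu> z + ennreal (2 ^ (CARD('n) + 1))"
proof -
  let ?C = "2 ^ (CARD('n) + 1) :: real"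
  note sets_borel_id[OF sets, measurable]
  have pointwise: "kernel s d x y \<le> ?C * kernel s 0 z y +
      (if d < norm (x - y) then d / norm (x - y) ^ (CARD('n) + 1) else 0)" for y
  proof (cases "d < norm (x - y)")
    case True
    have "s *\<^sub>R (x - y) - s *\<^sub>R (z - y) = s *\<^sub>R (x - z)" by (simp add: algebra_simps)
    then have n: "norm (s *\<^sub>R (x - y) - s *\<^sub>R (z - y)) = norm (x - z)" using s by simp
    have "P (s *\<^sub>R (x - y)) \<le> ?C * P (s *\<^sub>R (z - y)) +
        norm (x - z) / norm (x - y) ^ (CARD('n) + 1)"
      using P_le_P_nearby[of "s *\<^sub>R (x - y)" "s *\<^sub>R (z - y)"] n s d True by simp
    also have "norm (x - z) / norm (x - y) ^ (CARD('n) + 1) \<le> d / norm (x - y) ^ (CARD('n) + 1)"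
      using d by (intro divide_right_mono) auto
    finally show ?thesis using True by (simp add: kernel_def[of s d] kernel_0)
  qed (simp add: kernel_def[of s d])
  have "potential s d \<mu> x \<le> (\<integral>\<^sup>+ y. ennreal ?C * ennreal (kernel s 0 z y) +
      ennreal (if d < norm (x - y) then d / norm (x - y) ^ (CARD('n) + 1) else 0) \<partial>\<mu>)"
    unfolding potential_def
  proof (rule nn_integral_mono)
    fix y
    let ?t = "if d < norm (x - y) then d / norm (x - y) ^ (CARD('n) + 1) else 0"
    have "0 \<le> ?t" using d(1) by simp
    then have "ennreal ?C * ennreal (kernel s 0 z y) + ennreal ?t = ennreal (?C * kernel s 0 z y + ?t)"
      by (simp add: ennreal_mult ennreal_plus del: power_Suc)
    then show "ennreal (kernel s d x y) \<le> ennreal ?C * ennreal (kernel s 0 z y) + ennreal ?t"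
      using ennreal_leI[OF pointwise[of y]] by (simp only:)
  qed
  also have "\<dots> = ennreal ?C * potential s 0 \<mu> z + (\<integral>\<^sup>+ y.
      ennreal (if d < norm (x - y) then d / norm (x - y) ^ (CARD('n) + 1) else 0) \<partial>\<mu>)"
    unfolding potential_def by (subst nn_integral_add) (auto simp: nn_integral_cmult)
  also have "\<dots> \<le> ennreal ?C * potential s 0 \<mu> z + ennreal ?C"
    by (intro add_left_mono growth_tail_le sets growth d)
  finally show ?thesis .
qed

text \<open>Bounds on a potential propagate from a carrier \<open>F\<close> of the measure to the whole space. If \<open>x\<close> lies in
the closure of \<open>F\<close>, every truncation at \<open>x\<close> is compared with the potential at a point of \<open>F\<close> closer
than the truncation radius. If \<open>x\<close> has distance \<open>r > 0\<close>
from \<open>F\<close>, the same comparison handles the truncation at \<open>2 r\<close>, and in the remaining ball the kernel is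
at most \<open>1 / r\<^sup>N\<close> on \<open>F\<close>, against a mass of at most \<open>(4 r)\<^sup>N\<close>.\<close>

lemma maximum_principle:
  fixes \<mu> :: "'n::finite spacetime measure"
  assumes sets: "sets \<mu> = sets borel" and growth: "has_growth \<mu>" and s: "\<bar>s\<bar> = 1"
    and F: "AE y in \<mu>. y \<in> F" and M: "\<And>z. z \<in> F \<Longrightarrow> potential s 0 \<mu> z \<le> M"
  shows "potential s 0 \<mu> x \<le> ennreal (2 ^ (CARD('n) + 1)) * M + ennreal (2 ^ (CARD('n) + 1)) + ennreal (4 ^ CARD('n))"
proof (cases "F = {}")
  case True
  have "potential s 0 \<mu> x = (\<integral>\<^sup>+ y. 0 \<partial>\<mu>)"
    unfolding potential_def using F True by (intro nn_integral_cong_AE) auto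
  then show ?thesis by simp
next
  case False
  let ?C = "ennreal (2 ^ (CARD('n) + 1))"
  note sets_borel_id[OF sets, measurable]
  have far: "potential s d \<mu> x \<le> ?C * M + ?C" if d: "d > 0" "infdist x F < d" for d
  proof -
    obtain z where z: "z \<in> F" "dist x z < d"
      using d(2) False bdd_below_image_dist[of x F]
      unfolding infdist_notempty[OF False] by (auto simp: cINF_less_iff)
    have "potential s d \<mu> x \<le> ?C * potential s 0 \<mu> z + ?C"
      using z d by (intro trunc_potential_le_nearby sets growth s) (auto simp: dist_norm)
    also have "\<dots> \<le> ?C * M + ?C"
      by (intro add_right_mono mult_left_mono M z) auto
    finally show ?thesis .
  qed
  show ?thesis
  proof (cases "infdist x F = 0")
    case True
    have "potential s 0 \<mu> x \<le> ?C * M + ?C"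
      unfolding potential_eq_SUP[OF sets] using True by (intro SUP_least far) auto
    then show ?thesis by (rule order_trans) simp
  next
    case False
    define r where "r = infdist x F"
    have r: "r > 0" using False infdist_nonneg[of x F] unfolding r_def by linarith
    let ?near = "\<lambda>y. ennreal (1 / r ^ CARD('n)) * indicator (ball x (4 * r)) y"
    have [measurable]: "ball x (4 * r) \<in> sets \<mu>" by (simp add: sets)
    have split: "AE y in \<mu>. ennreal (kernel s 0 x y) \<le> ennreal (kernel s (2 * r) x y) + ?near y"
      using F
    proof (eventually_elim)
      case (elim y)
      show ?case
      proof (cases "2 * r < norm (x - y)")
        case False
        have "r \<le> norm (x - y)" unfolding r_def using infdist_le[OF elim, of x] by (simp add: dist_norm)
        then have "x \<noteq> y" using r by auto
        have "P (s *\<^sub>R (x - y)) \<le> 1 / norm (x - y) ^ CARD('n)"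
          using P_le[of "s *\<^sub>R (x - y)"] s by simp
        also have "\<dots> \<le> 1 / r ^ CARD('n)"
          using r \<open>r \<le> norm (x - y)\<close> \<open>x \<noteq> y\<close>
          by (intro divide_left_mono power_mono mult_pos_pos zero_less_power) auto
        finally have "ennreal (kernel s 0 x y) \<le> ennreal (1 / r ^ CARD('n))"
          unfolding kernel_0 by (rule ennreal_leI)
        then show ?thesis
          using False r by (auto simp: dist_norm add_increasing)
      qed (simp add: kernel_def)
    qed
    have "potential s 0 \<mu> x \<le> (\<integral>\<^sup>+ y. ennreal (kernel s (2 * r) x y) + ?near y \<partial>\<mu>)"
      unfolding potential_def using split by (rule nn_integral_mono_AE)
    also have "\<dots> = potential s (2 * r) \<mu> x + ennreal (1 / r ^ CARD('n)) * emeasure \<mu> (ball x (4 * r))"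
      unfolding potential_def by (subst nn_integral_add) (auto simp: nn_integral_cmult_indicator sets)
    also have "\<dots> \<le> (?C * M + ?C) + ennreal (1 / r ^ CARD('n)) * ennreal ((4 * r) ^ CARD('n))"
      using r by (intro add_mono mult_left_mono far has_growthD[OF growth]) (auto simp: r_def)
    also have "ennreal (1 / r ^ CARD('n)) * ennreal ((4 * r) ^ CARD('n)) = ennreal (4 ^ CARD('n))"
      using r by (subst ennreal_mult[symmetric]) (auto simp: power_mult_distrib)
    finally show ?thesis .
  qed
qed

section \<open>The Schur test and the operator\<close>

text \<open>The Schur test: the Cauchy-Schwarz inequality for the factors \<open>sqrt (k x y)\<close> and
\<open>sqrt (k x y) * f y\<close>, in which the row bound disposes of the first factor; integrating the square of the
second in \<open>x\<close> first lets the column bound finish.\<close>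

lemma Schur_test_nn:
  assumes "sigma_finite_measure M"
    and k [measurable]: "(\<lambda>p. k (fst p) (snd p)) \<in> borel_measurable (M \<Otimes>\<^sub>M M)"
    and k0: "\<And>x y. 0 \<le> k x y"
    and row: "\<And>x. (\<integral>\<^sup>+ y. ennreal (k x y) \<partial>M) \<le> 1"
    and col: "\<And>y. (\<integral>\<^sup>+ x. ennreal (k x y) \<partial>M) \<le> 1"
    and f [measurable]: "f \<in> borel_measurable M"
  shows "(\<integral>\<^sup>+ x. (\<integral>\<^sup>+ y. ennreal (k x y) * f y \<partial>M)\<^sup>2 \<partial>M) \<le> (\<integral>\<^sup>+ y. (f y)\<^sup>2 \<partial>M)"
proof -
  interpret sigma_finite_measure M by fact
  interpret pair_sigma_finite M M ..
  have k1 [measurable]: "k x \<in> borel_measurable M" if "x \<in> space M" for x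
    using measurable_compose[OF measurable_Pair1'[OF that] k] by simp
  have "(\<integral>\<^sup>+ y. ennreal (k x y) * f y \<partial>M)\<^sup>2 \<le> (\<integral>\<^sup>+ y. ennreal (k x y) * (f y)\<^sup>2 \<partial>M)"
    if x: "x \<in> space M" for x
  proof -
    have root: "ennreal (sqrt (k x y)) * ennreal (sqrt (k x y)) = ennreal (k x y)" for y
      using k0 by (simp flip: ennreal_mult)
    have "(\<integral>\<^sup>+ y. ennreal (k x y) * f y \<partial>M)\<^sup>2
        = (\<integral>\<^sup>+ y. ennreal (sqrt (k x y)) * (ennreal (sqrt (k x y)) * f y) \<partial>M)\<^sup>2"
      by (simp only: root mult.assoc[symmetric])
    also have "\<dots> \<le> (\<integral>\<^sup>+ y. (ennreal (sqrt (k x y)))\<^sup>2 \<partial>M) * (\<integral>\<^sup>+ y. (ennreal (sqrt (k x y)) * f y)\<^sup>2 \<partial>M)"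
      using x by (intro Cauchy_Schwarz_nn_integral) measurable
    also have "\<dots> = (\<integral>\<^sup>+ y. ennreal (k x y) \<partial>M) * (\<integral>\<^sup>+ y. ennreal (k x y) * (f y)\<^sup>2 \<partial>M)"
      by (simp only: power_mult_distrib power2_eq_square[of "ennreal _"] root)
    also have "\<dots> \<le> 1 * (\<integral>\<^sup>+ y. ennreal (k x y) * (f y)\<^sup>2 \<partial>M)"
      by (intro mult_right_mono row) simp
    finally show ?thesis by simp
  qed
  then have "(\<integral>\<^sup>+ x. (\<integral>\<^sup>+ y. ennreal (k x y) * f y \<partial>M)\<^sup>2 \<partial>M)
      \<le> (\<integral>\<^sup>+ x. (\<integral>\<^sup>+ y. ennreal (k x y) * (f y)\<^sup>2 \<partial>M) \<partial>M)"
    by (rule nn_integral_mono)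
  also have "\<dots> = (\<integral>\<^sup>+ y. (\<integral>\<^sup>+ x. ennreal (k x y) * (f y)\<^sup>2 \<partial>M) \<partial>M)"
    by (intro Fubini'[symmetric]) (simp add: case_prod_beta)
  also have "\<dots> \<le> (\<integral>\<^sup>+ y. (f y)\<^sup>2 \<partial>M)"
  proof (rule nn_integral_mono)
    fix y assume y: "y \<in> space M"
    have "(\<lambda>x. k x y) \<in> borel_measurable M"
      using measurable_compose[OF measurable_Pair2'[OF y] k] by simp
    then have "(\<integral>\<^sup>+ x. ennreal (k x y) * (f y)\<^sup>2 \<partial>M) = (\<integral>\<^sup>+ x. ennreal (k x y) \<partial>M) * (f y)\<^sup>2"
      by (intro nn_integral_multc) auto
    also have "\<dots> \<le> 1 * (f y)\<^sup>2" by (intro mult_right_mono col) simp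
    finally show "(\<integral>\<^sup>+ x. ennreal (k x y) * (f y)\<^sup>2 \<partial>M) \<le> (f y)\<^sup>2" by simp
  qed
  finally show ?thesis .
qed

lemma trunc_ok_iff: "trunc_ok \<mu> e f x \<longleftrightarrow> integrable \<mu> (\<lambda>y. kernel 1 e x y * f y)"
  unfolding trunc_ok_def set_integrable_def
  by (intro arg_cong[where f = "integrable \<mu>"] ext) (simp add: kernel_def indicator_def)

lemma T_trunc_eq: "T_trunc \<mu> e f x = (\<integral>y. kernel 1 e x y * f y \<partial>\<mu>)"
  unfolding T_trunc_def set_lebesgue_integral_def
  by (intro arg_cong[where f = "integral\<^sup>L \<mu>"] ext) (simp add: kernel_def indicator_def)

text \<open>The Schur test applied to \<open>\<bar>f\<bar>\<close>; the finiteness of the dominating integral also yields that the truncated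
integrals exist almost everywhere.\<close>

lemma T_L2_bound_of_potential_le:
  fixes \<mu> :: "'n::finite spacetime measure"
  assumes radon: "radon_measure \<mu>"
    and row: "\<And>e x. e > 0 \<Longrightarrow> potential 1 e \<mu> x \<le> 1"
    and col: "\<And>e x. e > 0 \<Longrightarrow> potential (- 1) e \<mu> x \<le> 1"
  shows "T_L2_bound \<mu> 1"
  unfolding T_L2_bound_def
proof (intro allI impI ballI)
  fix e :: real and f assume e: "e > 0" and f: "f \<in> L2 \<mu>"
  have sets: "sets \<mu> = sets borel" using radon by (simp add: radon_measure_def)
  interpret sigma_finite_measure \<mu> by (rule radon_sigma_finite[OF radon])
  note sets_borel_id[OF sets, measurable]
  have fm [measurable]: "f \<in> borel_measurable \<mu>" and f2: "integrable \<mu> (\<lambda>x. (f x)\<^sup>2)"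
    using f by (auto simp: L2_def)
  define G where "G x = (\<integral>\<^sup>+ y. ennreal (kernel 1 e x y) * ennreal \<bar>f y\<bar> \<partial>\<mu>)" for x
  have Gm [measurable]: "G \<in> borel_measurable \<mu>" unfolding G_def[abs_def] by measurable
  have "(\<integral>\<^sup>+ x. (G x)\<^sup>2 \<partial>\<mu>) \<le> (\<integral>\<^sup>+ y. (ennreal \<bar>f y\<bar>)\<^sup>2 \<partial>\<mu>)"
    unfolding G_def
  proof (rule Schur_test_nn)
    show "(\<integral>\<^sup>+ y. ennreal (kernel 1 e x y) \<partial>\<mu>) \<le> 1" for x
      using row[OF e, of x] by (simp add: potential_def)
    show "(\<integral>\<^sup>+ x. ennreal (kernel 1 e x y) \<partial>\<mu>) \<le> 1" for y
      using col[OF e, of y] by (simp add: potential_def kernel_swap[of 1])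
  qed (auto intro: sigma_finite_measure_axioms)
  also have "\<dots> = (\<integral>\<^sup>+ y. ennreal ((f y)\<^sup>2) \<partial>\<mu>)"
    by (simp add: ennreal_power)
  also have "\<dots> = ennreal (\<integral>y. (f y)\<^sup>2 \<partial>\<mu>)"
    using f2 by (intro nn_integral_eq_integral) auto
  finally have G2: "(\<integral>\<^sup>+ x. (G x)\<^sup>2 \<partial>\<mu>) \<le> ennreal (\<integral>y. (f y)\<^sup>2 \<partial>\<mu>)" .
  have norm_eq: "ennreal (norm (kernel 1 e x y * f y)) = ennreal (kernel 1 e x y) * ennreal \<bar>f y\<bar>" for x y
    by (simp add: abs_mult ennreal_mult)
  have "AE x in \<mu>. (G x)\<^sup>2 \<noteq> \<infinity>"
    using G2 by (intro nn_integral_PInf_AE) (auto simp: top_unique)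
  then have ok: "AE x in \<mu>. trunc_ok \<mu> e f x"
  proof eventually_elim
    case (elim x)
    then have "G x < \<infinity>" by (simp add: less_top power_eq_top_ennreal)
    moreover have "(\<lambda>y. kernel 1 e x y * f y) \<in> borel_measurable \<mu>" by measurable
    ultimately show ?case
      unfolding trunc_ok_iff integrable_iff_bounded norm_eq G_def by blast
  qed
  have Tm [measurable]: "T_trunc \<mu> e f \<in> borel_measurable \<mu>"
    unfolding T_trunc_eq[abs_def] by measurable
  have T_le: "ennreal (norm (T_trunc \<mu> e f x)) \<le> G x" for x
  proof (cases "integrable \<mu> (\<lambda>y. kernel 1 e x y * f y)")
    case True
    then show ?thesis
      unfolding T_trunc_eq G_def norm_eq[symmetric] by (rule integral_norm_bound_ennreal)
  qed (simp add: T_trunc_eq not_integrable_integral_eq)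
  have "(\<integral>\<^sup>+ x. ennreal (norm ((T_trunc \<mu> e f x)\<^sup>2)) \<partial>\<mu>) \<le> (\<integral>\<^sup>+ x. (G x)\<^sup>2 \<partial>\<mu>)"
  proof (rule nn_integral_mono)
    fix x
    show "ennreal (norm ((T_trunc \<mu> e f x)\<^sup>2)) \<le> (G x)\<^sup>2"
      using power_mono[OF T_le[of x], of 2] by (simp add: ennreal_power)
  qed
  then have T2: "(\<integral>\<^sup>+ x. ennreal (norm ((T_trunc \<mu> e f x)\<^sup>2)) \<partial>\<mu>) \<le> ennreal (\<integral>y. (f y)\<^sup>2 \<partial>\<mu>)"
    using G2 by (rule order_trans)
  then have Tint: "integrable \<mu> (\<lambda>x. (T_trunc \<mu> e f x)\<^sup>2)"
    unfolding integrable_iff_bounded by (auto intro: le_less_trans)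
  then have "ennreal (\<integral>x. (T_trunc \<mu> e f x)\<^sup>2 \<partial>\<mu>) = (\<integral>\<^sup>+ x. ennreal ((T_trunc \<mu> e f x)\<^sup>2) \<partial>\<mu>)"
    by (intro nn_integral_eq_integral[symmetric]) auto
  then have "ennreal (\<integral>x. (T_trunc \<mu> e f x)\<^sup>2 \<partial>\<mu>) \<le> ennreal (\<integral>y. (f y)\<^sup>2 \<partial>\<mu>)"
    using T2 by simp
  then have "(\<integral>x. (T_trunc \<mu> e f x)\<^sup>2 \<partial>\<mu>) \<le> (\<integral>y. (f y)\<^sup>2 \<partial>\<mu>)"
    by (subst (asm) ennreal_le_iff) auto
  then show "(AE x in \<mu>. trunc_ok \<mu> e f x) \<and> T_trunc \<mu> e f \<in> L2 \<mu> \<and>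
      L2_norm \<mu> (T_trunc \<mu> e f) \<le> 1 * L2_norm \<mu> f"
    using ok Tint by (simp add: L2_def L2_norm_def)
qed

section \<open>From bounded potentials to growth and uniform truncation bounds\<close>

lemma AE_lborel_open_ex:
  fixes U :: "'a::euclidean_space set"
  assumes "AE z in lborel. Q z" "open U" "U \<noteq> {}"
  obtains z where "z \<in> U" "Q z"
proof (rule ccontr)
  assume "\<not> thesis"
  then have "\<forall>z\<in>U. \<not> Q z" using that by blast
  then have "AE z in lborel. z \<notin> U" using assms(1) by (auto elim: eventually_mono)
  then have "U \<in> null_sets lborel" using assms(2) by (subst AE_iff_null_sets) auto
  then have "negligible U" by (simp add: negligible_iff_null_sets null_sets_completionI)
  then show False using open_not_negligible assms by blast
qed

text \<open>A Lebesgue-a.e. bound on the potential controls its truncations at every point, in particular at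
almost every point of a measure that may be singular. The truncation at \<open>x\<close> is compared, through
\<open>P_le_P_upward\<close>, with the potential at a point \<open>z\<close> where the a.e. bound holds. Such a point exists in
an open ball all of whose points are less than \<open>e\<close> away from \<open>x\<close> and later in time than \<open>x\<close> (earlier for the adjoint).\<close>

lemma trunc_potential_le_of_AE:
  fixes \<mu> :: "'n::finite spacetime measure"
  assumes sets: "sets \<mu> = sets borel" and s: "\<bar>s\<bar> = 1" and e: "e > 0"
    and AE: "AE z in lborel. potential s 0 \<mu> z \<le> 1"
  shows "potential s e \<mu> x \<le> ennreal (2 ^ (CARD('n) + 1))"
proof -
  let ?C = "2 ^ (CARD('n) + 1) :: real"
  note sets_borel_id[OF sets, measurable]
  define c :: "'n spacetime" where "c = x + s *\<^sub>R (0, e / 2)"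
  obtain z where z: "z \<in> ball c (e / 2)" "potential s 0 \<mu> z \<le> 1"
    using AE_lborel_open_ex[OF AE, of "ball c (e / 2)"] e by auto
  define w where "w = s *\<^sub>R (z - x)"
  define v where "v = s *\<^sub>R (z - c)"
  have ss: "s * s = 1" using s by (auto simp: abs_if split: if_splits)
  have w: "w = (0, e / 2) + v"
    using ss by (simp add: w_def v_def c_def algebra_simps)
  have v: "norm v < e / 2" using z s by (simp add: v_def dist_norm norm_minus_commute)
  have "norm w \<le> norm ((0, e / 2) :: 'n spacetime) + norm v" unfolding w by (rule norm_triangle_ineq)
  then have norm_w: "norm w < e" using v e by (simp add: norm_Pair)
  have snd_w: "0 \<le> snd w" using abs_snd_le_norm[of v] v by (simp add: w)
  have pointwise: "kernel s e x y \<le> ?C * kernel s 0 z y" for y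
  proof (cases "e < norm (x - y)")
    case True
    have "P (s *\<^sub>R (x - y)) \<le> ?C * P (s *\<^sub>R (x - y) + w)"
      using True norm_w s by (intro P_le_P_upward snd_w) auto
    also have "s *\<^sub>R (x - y) + w = s *\<^sub>R (z - y)" by (simp add: w_def algebra_simps)
    finally show ?thesis using True by (simp add: kernel_def[of s e] kernel_0)
  qed (simp add: kernel_def[of s e])
  have "potential s e \<mu> x \<le> (\<integral>\<^sup>+ y. ennreal ?C * ennreal (kernel s 0 z y) \<partial>\<mu>)"
    unfolding potential_def using ennreal_leI[OF pointwise]
    by (intro nn_integral_mono) (simp add: ennreal_mult del: power_Suc)
  also have "\<dots> = ennreal ?C * potential s 0 \<mu> z"
    unfolding potential_def by (rule nn_integral_cmult) measurable
  also have "\<dots> \<le> ennreal ?C * 1" by (intro mult_left_mono z) simp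
  finally show ?thesis by simp
qed

text \<open>Seen from a point at height about \<open>5 r / 2\<close> above the centre, the kernel is at least
\<open>r / (4 r)\<^sup>N\<^sup>+\<^sup>1\<close> on the whole ball of radius \<open>r\<close>, so a potential bounded by 1 limits the mass of the ball.\<close>

lemma growth_of_AE_potential_le:
  fixes \<mu> :: "'n::finite spacetime measure"
  assumes sets: "sets \<mu> = sets borel" and r: "r > 0"
    and AE: "AE z in lborel. potential 1 0 \<mu> z \<le> 1"
  shows "emeasure \<mu> (ball x r) \<le> ennreal (4 ^ (CARD('n) + 1) * r ^ CARD('n))"
proof -
  let ?N = "CARD('n)"
  let ?a = "1 / (4 ^ (?N + 1) * r ^ ?N)"
  have a: "?a > 0" using r by simp
  define h :: "'n spacetime" where "h = (0, 5 / 2 * r)"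
  obtain z where z: "z \<in> ball (x + h) (r / 2)" "potential 1 0 \<mu> z \<le> 1"
    using AE_lborel_open_ex[OF AE, of "ball (x + h) (r / 2)"] r by auto
  have lower: "?a \<le> kernel 1 0 z y" if y: "y \<in> ball x r" for y
  proof -
    define u v where "u = z - (x + h)" and "v = x - y"
    have u: "norm u < r / 2" and v: "norm v < r"
      using z y by (auto simp: u_def v_def dist_norm norm_minus_commute)
    have zy: "z - y = h + (u + v)" by (simp add: u_def v_def)
    have nh: "norm h = 5 / 2 * r" using r by (simp add: h_def norm_Pair)
    have "norm (z - y) \<le> norm h + (norm u + norm v)"
      unfolding zy by (metis norm_triangle_ineq norm_triangle_le add_left_mono order_trans)
    then have n: "norm (z - y) \<le> 4 * r" using nh u v by simp
    have t: "r \<le> snd (z - y)"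
      using abs_snd_le_norm[of u] abs_snd_le_norm[of v] u v unfolding zy by (simp add: h_def)
    then have "z - y \<noteq> 0" using r by auto
    have "?a = r / (4 * r) ^ (?N + 1)" using r by (simp add: power_mult_distrib)
    also have "\<dots> \<le> r / norm (z - y) ^ (?N + 1)"
      using r n \<open>z - y \<noteq> 0\<close> by (intro divide_left_mono power_mono mult_pos_pos zero_less_power) auto
    also have "\<dots> \<le> P (z - y)"
      unfolding P_eq using t by (intro divide_right_mono) auto
    finally show ?thesis by (simp add: kernel_0)
  qed
  have "ennreal ?a * emeasure \<mu> (ball x r) = (\<integral>\<^sup>+ y. ennreal ?a * indicator (ball x r) y \<partial>\<mu>)"
    by (simp add: nn_integral_cmult_indicator sets)
  also have "\<dots> \<le> potential 1 0 \<mu> z"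
    unfolding potential_def using lower
    by (intro nn_integral_mono) (auto simp: indicator_def intro!: ennreal_leI)
  also have "\<dots> \<le> 1" by (rule z)
  finally have *: "ennreal ?a * emeasure \<mu> (ball x r) \<le> 1" .
  have "ennreal (1 / ?a) * ennreal ?a = ennreal (1 / ?a * ?a)"
    using a by (intro ennreal_mult[symmetric]) simp_all
  also have "1 / ?a * ?a = 1" using r by simp
  finally have "ennreal (1 / ?a) * ennreal ?a = 1" by simp
  then have "emeasure \<mu> (ball x r) = ennreal (1 / ?a) * (ennreal ?a * emeasure \<mu> (ball x r))"
    by (simp only: mult.assoc[symmetric] mult_1)
  also have "\<dots> \<le> ennreal (1 / ?a) * 1" by (intro mult_left_mono *) simp
  finally show ?thesis by simp
qed

section \<open>From an L2 bound to bounded potentials\<close>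

text \<open>The L2 hypothesis enters only through the test function \<open>1\<^sub>K\<close>. For \<open>g = T_\<epsilon>(1\<^sub>K \<mu>)\<close>, the
elementary inequality \<open>g \<le> (1 + g\<^sup>2) / 2\<close> gives that the integral of \<open>g\<close> over \<open>K\<close> is at most the average
of \<open>\<mu> K\<close> and the squared L2 norm of \<open>g\<close>, which is at most \<open>\<mu> K\<close> as well.\<close>

lemma energy_le_of_T_L2_bound:
  fixes \<mu> :: "'n::finite spacetime measure"
  assumes radon: "radon_measure \<mu>" and bound: "T_L2_bound \<mu> 1" and K: "compact K"
  defines "\<kappa> \<equiv> density \<mu> (indicator K)"
  shows "(\<integral>\<^sup>+ x. potential 1 0 \<kappa> x \<partial>\<kappa>) \<le> emeasure \<mu> K"
proof -
  have sets: "sets \<mu> = sets borel" and fin: "emeasure \<mu> K < \<infinity>"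
    using radon K by (auto simp: radon_measure_def)
  have Km [measurable]: "K \<in> sets \<mu>" using K sets by (simp add: borel_compact)
  interpret sigma_finite_measure \<mu> by (rule radon_sigma_finite[OF radon])
  note sets_borel_id[OF sets, measurable]
  have sets_\<kappa>: "sets \<kappa> = sets borel" by (simp add: \<kappa>_def sets)
  have radon_\<kappa>: "radon_measure \<kappa>"
    unfolding \<kappa>_def by (rule radon_density[OF radon]) (auto simp: indicator_def)
  note sf_\<kappa> = radon_sigma_finite[OF radon_\<kappa>]
  have meas: "potential 1 e \<kappa> \<in> borel_measurable M" if "sets M = sets borel" for e M
    using potential_measurable[OF sf_\<kappa> sets_\<kappa>, of 1 e] that by (simp cong: measurable_cong_sets)
  have trunc: "(\<integral>\<^sup>+ x. potential 1 e \<kappa> x \<partial>\<kappa>) \<le> emeasure \<mu> K" if e: "e > 0" for e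
  proof -
    define f :: "'n spacetime \<Rightarrow> real" where "f = indicator K"
    define g where "g = T_trunc \<mu> e f"
    have fint: "integrable \<mu> f" using fin by (simp add: f_def)
    have ff: "(\<lambda>x. (f x)\<^sup>2) = f" by (auto simp: f_def indicator_def)
    have "f \<in> L2 \<mu>" using fint ff by (auto simp: L2_def)
    then have ok: "AE x in \<mu>. trunc_ok \<mu> e f x" and "g \<in> L2 \<mu>" and gf: "L2_norm \<mu> g \<le> L2_norm \<mu> f"
      using bound e unfolding T_L2_bound_def g_def by auto
    then have gint: "integrable \<mu> (\<lambda>x. (g x)\<^sup>2)" by (simp add: L2_def)
    have "(\<integral>x. (g x)\<^sup>2 \<partial>\<mu>) \<le> (\<integral>x. f x \<partial>\<mu>)"
      using gf unfolding L2_norm_def ff by simp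
    moreover have int_f: "(\<integral>x. f x \<partial>\<mu>) = measure \<mu> K" using Km by (simp add: f_def)
    ultimately have g2: "(\<integral>x. (g x)\<^sup>2 \<partial>\<mu>) \<le> measure \<mu> K" by simp
    have AEg: "AE x in \<mu>. potential 1 e \<kappa> x = ennreal (g x)"
      using ok
    proof eventually_elim
      case (elim x)
      have "potential 1 e \<kappa> x = (\<integral>\<^sup>+ y. ennreal (kernel 1 e x y * f y) \<partial>\<mu>)"
        unfolding \<kappa>_def f_def using Km
        by (subst potential_density[OF sets]) (auto intro!: nn_integral_cong simp: indicator_def)
      also have "\<dots> = ennreal (g x)"
        using elim unfolding g_def T_trunc_eq trunc_ok_iff
        by (intro nn_integral_eq_integral) (auto simp: f_def)
      finally show ?case .
    qed
    have "(\<integral>\<^sup>+ x. potential 1 e \<kappa> x \<partial>\<kappa>) = (\<integral>\<^sup>+ x. indicator K x * potential 1 e \<kappa> x \<partial>\<mu>)"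
      using meas[OF sets] unfolding \<kappa>_def by (intro nn_integral_density) auto
    also have "\<dots> \<le> (\<integral>\<^sup>+ x. ennreal ((f x + (g x)\<^sup>2) / 2) \<partial>\<mu>)"
    proof (rule nn_integral_mono_AE)
      show "AE x in \<mu>. indicator K x * potential 1 e \<kappa> x \<le> ennreal ((f x + (g x)\<^sup>2) / 2)"
        using AEg
      proof eventually_elim
        case (elim x)
        have "2 * g x \<le> 1 + (g x)\<^sup>2"
          using zero_le_power2[of "g x - 1"] by (simp add: power2_diff)
        then show ?case using elim by (auto simp: f_def indicator_def intro!: ennreal_leI)
      qed
    qed
    also have "\<dots> = ennreal (\<integral>x. (f x + (g x)\<^sup>2) / 2 \<partial>\<mu>)"
      using fint gint by (intro nn_integral_eq_integral) (auto simp: f_def)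
    also have "(\<integral>x. (f x + (g x)\<^sup>2) / 2 \<partial>\<mu>) = (measure \<mu> K + (\<integral>x. (g x)\<^sup>2 \<partial>\<mu>)) / 2"
      using fint gint int_f by simp
    also have "ennreal \<dots> \<le> ennreal (measure \<mu> K)" using g2 by (intro ennreal_leI) simp
    also have "\<dots> = emeasure \<mu> K" using fin by (simp add: emeasure_eq_ennreal_measure)
    finally show ?thesis .
  qed
  have inc: "incseq (\<lambda>n. potential 1 (1 / Suc n) \<kappa>)"
    by (intro incseq_SucI le_funI potential_antimono) (simp add: field_simps)
  have "(\<integral>\<^sup>+ x. potential 1 0 \<kappa> x \<partial>\<kappa>) = (SUP n. \<integral>\<^sup>+ x. potential 1 (1 / Suc n) \<kappa> x \<partial>\<kappa>)"
    unfolding potential_eq_SUP[OF sets_\<kappa>]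
    by (rule nn_integral_monotone_convergence_SUP[OF inc]) (rule meas[OF sets_\<kappa>])
  also have "\<dots> \<le> emeasure \<mu> K" by (intro SUP_least trunc) simp
  finally show ?thesis .
qed

text \<open>The potential and the adjoint potential have the same integral by Tonelli, so by the Markov inequality
each of them exceeds 4 on at most a quarter of the mass.\<close>

lemma half_mass_bounded_potentials:
  fixes \<kappa> :: "'n::finite spacetime measure"
  assumes sets: "sets \<kappa> = sets borel" and fin: "emeasure \<kappa> UNIV < \<infinity>"
    and energy: "(\<integral>\<^sup>+ x. potential 1 0 \<kappa> x \<partial>\<kappa>) \<le> emeasure \<kappa> UNIV"
  obtains F where "F \<in> sets borel" "emeasure \<kappa> UNIV \<le> 2 * emeasure \<kappa> F"
    "\<And>s x. s \<in> {1, - 1} \<Longrightarrow> x \<in> F \<Longrightarrow> potential s 0 \<kappa> x \<le> 4"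
proof -
  have sp: "space \<kappa> = UNIV" using sets_eq_imp_space_eq[OF sets] by simp
  interpret finite_measure \<kappa> by (rule finite_measureI, unfold sp, rule less_imp_neq[OF fin])
  have sf: "sigma_finite_measure \<kappa>" by (rule sigma_finite_measure_axioms)
  interpret pair_sigma_finite \<kappa> \<kappa> ..
  note sets_borel_id[OF sets, measurable]
  have meas: "potential s 0 \<kappa> \<in> borel_measurable \<kappa>" for s
    using potential_measurable[OF sf sets, of s 0] sets
    by (simp cong: measurable_cong_sets)
  have "(\<integral>\<^sup>+ x. potential (- 1) 0 \<kappa> x \<partial>\<kappa>) = (\<integral>\<^sup>+ x. \<integral>\<^sup>+ y. ennreal (kernel 1 0 y x) \<partial>\<kappa> \<partial>\<kappa>)"
    unfolding potential_def by (simp add: kernel_swap[of "- 1"])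
  also have "\<dots> = (\<integral>\<^sup>+ x. potential 1 0 \<kappa> x \<partial>\<kappa>)"
    unfolding potential_def by (rule Fubini') measurable
  finally have energy': "(\<integral>\<^sup>+ x. potential s 0 \<kappa> x \<partial>\<kappa>) \<le> emeasure \<kappa> UNIV" if "s \<in> {1, - 1}" for s
    using energy that by auto
  define B where "B s = {x \<in> UNIV. 1 \<le> ennreal (1 / 4) * potential s 0 \<kappa> x}" for s
  have Bm: "B s \<in> sets \<kappa>" for s
  proof -
    have [measurable]: "potential s 0 \<kappa> \<in> borel_measurable \<kappa>" by (rule meas)
    show ?thesis unfolding B_def sp[symmetric] by measurable
  qed
  have B_le: "emeasure \<kappa> (B s) \<le> ennreal (1 / 4) * emeasure \<kappa> UNIV" if "s \<in> {1, - 1}" for s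
  proof -
    have "emeasure \<kappa> (B s) \<le> ennreal (1 / 4) * (\<integral>\<^sup>+ x. potential s 0 \<kappa> x * indicator UNIV x \<partial>\<kappa>)"
      unfolding B_def using meas sets.top[of \<kappa>] sp by (intro nn_integral_Markov_inequality) auto
    also have "\<dots> \<le> ennreal (1 / 4) * emeasure \<kappa> UNIV"
      using energy'[OF that] by (intro mult_left_mono) auto
    finally show ?thesis .
  qed
  define F where "F = - (B 1 \<union> B (- 1))"
  have Fm: "F \<in> sets \<kappa>" using Bm sets.compl_sets[of "B 1 \<union> B (- 1)" \<kappa>] sp
    by (simp add: F_def Compl_eq_Diff_UNIV)
  have "emeasure \<kappa> UNIV = emeasure \<kappa> (F \<union> (B 1 \<union> B (- 1)))"
    unfolding F_def by (simp only: Compl_partition2)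
  also have "\<dots> \<le> emeasure \<kappa> F + (emeasure \<kappa> (B 1) + emeasure \<kappa> (B (- 1)))"
    using Fm Bm by (intro order_trans[OF emeasure_subadditive] add_left_mono emeasure_subadditive) auto
  also have "\<dots> \<le> emeasure \<kappa> F + (ennreal (1 / 4) * emeasure \<kappa> UNIV + ennreal (1 / 4) * emeasure \<kappa> UNIV)"
    by (intro add_left_mono add_mono B_le) auto
  finally have "emeasure \<kappa> UNIV \<le> 2 * emeasure \<kappa> F"
    unfolding emeasure_eq_measure
    by (simp add: ennreal_mult[symmetric] ennreal_plus[symmetric] ennreal_numeral[symmetric] 
         del: ennreal_plus ennreal_numeral)
  moreover have "potential s 0 \<kappa> x \<le> 4" if "s \<in> {1, - 1}" "x \<in> F" for s x
  proof -
    have "x \<notin> B s" using that by (auto simp: F_def)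
    then have *: "ennreal (1 / 4) * potential s 0 \<kappa> x < 1" by (simp add: B_def not_le)
    show ?thesis
    proof (cases "potential s 0 \<kappa> x")
      case (real u)
      have "ennreal (1 / 4) * ennreal u = ennreal (1 / 4 * u)"
        using real by (intro ennreal_mult[symmetric]) auto
      then have "ennreal (1 / 4 * u) < ennreal 1" using * unfolding real by (simp only: ennreal_1)
      then have "u \<le> 4" using real by (subst (asm) ennreal_less_iff) auto
      then have "ennreal u \<le> ennreal 4" by (rule ennreal_leI)
      then show ?thesis using real by simp
    qed (use * in \<open>simp add: ennreal_mult_top\<close>)
  qed
  ultimately show thesis using that Fm sets by auto
qed

section \<open>Comparison of the capacities\<close>

text \<open>The factor \<open>1 / 4\<^sup>N\<^sup>+\<^sup>1\<close> normalises the growth constant; it also brings the truncated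
potentials, which are at most \<open>2\<^sup>N\<^sup>+\<^sup>1\<close>, below the bound 1 that the Schur test asks for.\<close>

lemma capacity_L2_witness:
  fixes \<mu> :: "'n::finite spacetime measure"
  assumes radon: "radon_measure \<mu>"
    and T: "esssup lborel (T \<mu>) \<le> 1" and T_adj: "esssup lborel (T_adj \<mu>) \<le> 1"
  defines "\<nu> \<equiv> density \<mu> (\<lambda>_. ennreal (1 / 4 ^ (CARD('n) + 1)))"
  shows "radon_measure \<nu>" "msupp \<nu> \<subseteq> msupp \<mu>" "has_growth \<nu>" "T_L2_bound \<nu> 1"
    "emeasure \<mu> UNIV = ennreal (4 ^ (CARD('n) + 1)) * emeasure \<nu> UNIV"
proof -
  let ?C = "4 ^ (CARD('n) + 1) :: real"
  have C1: "1 \<le> ?C" by (rule one_le_power) simp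
  have c: "ennreal (1 / ?C) \<le> 1" using C1 by (subst ennreal_1[symmetric], intro ennreal_leI) simp
  have cC: "ennreal ?C * ennreal (1 / ?C) = 1" by (subst ennreal_mult[symmetric]) auto
  have sets: "sets \<mu> = sets borel" using radon by (simp add: radon_measure_def)
  have emeasure_\<nu>: "emeasure \<nu> A = ennreal (1 / ?C) * emeasure \<mu> A" if "A \<in> sets borel" for A
    using that unfolding \<nu>_def by (intro emeasure_density_const) (simp add: sets)
  show radon_\<nu>: "radon_measure \<nu>"
    unfolding \<nu>_def by (rule radon_density[OF radon]) (use c in auto)
  show "msupp \<nu> \<subseteq> msupp \<mu>" unfolding \<nu>_def by (rule msupp_density[OF sets]) simp
  show "emeasure \<mu> UNIV = ennreal ?C * emeasure \<nu> UNIV"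
    by (subst emeasure_\<nu>, simp, simp only: mult.assoc[symmetric] cC mult_1)
  have AE: "AE z in lborel. potential s 0 \<mu> z \<le> 1" if "s \<in> {1, - 1}" for s
  proof -
    have "esssup lborel (potential s 0 \<mu>) \<le> 1"
      using T T_adj that by (auto simp: T_eq_potential T_adj_eq_potential)
    then show ?thesis using esssup_AE[of "potential s 0 \<mu>" lborel] by (auto elim: eventually_mono order_trans)
  qed
  show "has_growth \<nu>"
    unfolding has_growth_def
  proof (intro allI impI)
    fix x :: "'n spacetime" and r :: real assume r: "r > 0"
    have "emeasure \<nu> (ball x r) = ennreal (1 / ?C) * emeasure \<mu> (ball x r)"
      by (rule emeasure_\<nu>) simp
    also have "\<dots> \<le> ennreal (1 / ?C) * ennreal (?C * r ^ CARD('n))"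
      by (intro mult_left_mono growth_of_AE_potential_le sets r AE) simp_all
    also have "\<dots> = ennreal (1 / ?C * (?C * r ^ CARD('n)))"
      using r by (intro ennreal_mult[symmetric]) auto
    finally show "emeasure \<nu> (ball x r) \<le> ennreal (r ^ CARD('n))" by simp
  qed
  have "potential s e \<nu> x \<le> 1" if "s \<in> {1, - 1}" "e > 0" for s e x
  proof -
    have "potential s e \<nu> x \<le> ennreal (1 / ?C) * ennreal (2 ^ (CARD('n) + 1))"
      unfolding \<nu>_def potential_density_const[OF sets] using that
      by (intro mult_left_mono trunc_potential_le_of_AE sets AE) auto
    also have "\<dots> = ennreal (1 / ?C * 2 ^ (CARD('n) + 1))"
      by (intro ennreal_mult[symmetric]) auto
    also have "1 / ?C * 2 ^ (CARD('n) + 1) \<le> 1"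
      using power_mono[of 2 "4 :: real" "CARD('n) + 1"] by (simp del: power_Suc)
    finally show ?thesis by (simp add: ennreal_leI)
  qed
  then show "T_L2_bound \<nu> 1" by (intro T_L2_bound_of_potential_le radon_\<nu>) auto
qed

text \<open>The measure \<open>\<mu>|\<^sub>K\<close> is restricted to a set that carries at least half of it and on which both potentials are at most 4; the maximum
principle then bounds them everywhere by \<open>D\<close>, and the restriction is divided by \<open>D\<close>. Passing to a compact
\<open>K\<close> makes the mass finite, as the Markov argument demands.\<close>

lemma capacity_plus_witness:
  fixes \<mu> :: "'n::finite spacetime measure"
  assumes radon: "radon_measure \<mu>" and growth: "has_growth \<mu>" and bound: "T_L2_bound \<mu> 1"
    and K: "compact K"
  defines "D \<equiv> 5 * 2 ^ (CARD('n) + 1) + 4 ^ CARD('n) :: real"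
  obtains \<nu> where "radon_measure \<nu>" "msupp \<nu> \<subseteq> msupp \<mu>"
    "esssup lborel (T \<nu>) \<le> 1" "esssup lborel (T_adj \<nu>) \<le> 1"
    "emeasure \<mu> K \<le> ennreal (2 * D) * emeasure \<nu> UNIV"
proof -
  have "1 \<le> (2 :: real) ^ (CARD('n) + 1)" "0 \<le> (4 :: real) ^ CARD('n)"
    by (auto intro: one_le_power simp del: power_Suc)
  then have D: "D \<ge> 1" unfolding D_def by linarith
  have sets: "sets \<mu> = sets borel" and fin: "emeasure \<mu> K < \<infinity>"
    using radon K by (auto simp: radon_measure_def)
  have Km: "K \<in> sets \<mu>" using K sets by (simp add: borel_compact)
  define \<kappa> where "\<kappa> = density \<mu> (indicator K)"
  have sets_\<kappa>: "sets \<kappa> = sets borel" by (simp add: \<kappa>_def sets)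
  have mass_\<kappa>: "emeasure \<kappa> UNIV = emeasure \<mu> K"
    using Km sets.top[of \<mu>] sets_eq_imp_space_eq[OF sets]
    unfolding \<kappa>_def by (subst emeasure_density) auto
  have indK: "indicator K \<in> borel_measurable \<mu>" "\<And>x. indicator K x \<le> (1 :: ennreal)"
    using Km by (auto simp: indicator_def)
  obtain F where F: "F \<in> sets borel" "emeasure \<kappa> UNIV \<le> 2 * emeasure \<kappa> F"
    and F_le: "\<And>s x. s \<in> {1, - 1} \<Longrightarrow> x \<in> F \<Longrightarrow> potential s 0 \<kappa> x \<le> 4"
    using half_mass_bounded_potentials[OF sets_\<kappa>] energy_le_of_T_L2_bound[OF radon bound K] fin
    unfolding mass_\<kappa> unfolding \<kappa>_def by blast
  have indF: "indicator F \<in> borel_measurable \<kappa>" "\<And>x. indicator F x \<le> (1 :: ennreal)"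
    using F sets_\<kappa> by (auto simp: indicator_def)
  define \<rho> where "\<rho> = density \<kappa> (indicator F)"
  have sets_\<rho>: "sets \<rho> = sets borel" by (simp add: \<rho>_def sets_\<kappa>)
  have radon_\<rho>: "radon_measure \<rho>"
    unfolding \<rho>_def \<kappa>_def by (intro radon_density radon indK indF[unfolded \<kappa>_def])
  have growth_\<rho>: "has_growth \<rho>"
    unfolding \<rho>_def \<kappa>_def by (intro has_growth_density growth indK indF[unfolded \<kappa>_def])
  have supp_\<rho>: "msupp \<rho> \<subseteq> msupp \<mu>"
    using msupp_density[OF sets indK(1)] msupp_density[OF sets_\<kappa> indF(1)]
    unfolding \<rho>_def \<kappa>_def by blast
  have mass_\<rho>: "emeasure \<rho> UNIV = emeasure \<kappa> F"
    using F(1) sets.top[of \<kappa>] sets_\<kappa> sets_eq_imp_space_eq[OF sets_\<kappa>]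
    unfolding \<rho>_def by (subst emeasure_density) auto
  have pot_\<rho>: "potential s 0 \<rho> x \<le> ennreal D" if s: "s \<in> {1, - 1}" for s x
  proof -
    let ?A = "2 ^ (CARD('n) + 1) :: real"
    have "potential s 0 \<rho> x \<le> ennreal ?A * 4 + ennreal ?A + ennreal (4 ^ CARD('n))"
    proof (rule maximum_principle[OF sets_\<rho> growth_\<rho>])
      show "AE y in \<rho>. y \<in> F"
        unfolding \<rho>_def using indF(1) by (subst AE_density) (auto simp: indicator_def)
      show "potential s 0 \<rho> z \<le> 4" if "z \<in> F" for z
        using potential_density_le[OF sets_\<kappa> indF] F_le[OF s that] unfolding \<rho>_def by (rule order_trans)
    qed (use s in auto)
    also have "ennreal ?A * 4 = ennreal (?A * 4)" by (subst ennreal_mult) auto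
    also have "ennreal (?A * 4) + ennreal ?A + ennreal (4 ^ CARD('n)) = ennreal D"
      unfolding D_def by (simp add: ennreal_plus[symmetric] del: ennreal_plus)
    finally show ?thesis .
  qed
  define \<nu> where "\<nu> = density \<rho> (\<lambda>_. ennreal (1 / D))"
  have c: "ennreal (1 / D) \<le> 1" using D by (subst ennreal_1[symmetric], intro ennreal_leI) simp
  have Dc: "ennreal D * ennreal (1 / D) = 1" using D by (subst ennreal_mult[symmetric]) auto
  have sets_\<nu>: "sets \<nu> = sets borel" by (simp add: \<nu>_def sets_\<rho>)
  have radon_\<nu>: "radon_measure \<nu>"
    unfolding \<nu>_def by (rule radon_density[OF radon_\<rho>]) (use c in auto)
  have pot_\<nu>: "esssup lborel (potential s 0 \<nu>) \<le> 1" if s: "s \<in> {1, - 1}" for s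
  proof (rule esssup_I)
    show "potential s 0 \<nu> \<in> borel_measurable lborel"
      using potential_measurable[OF radon_sigma_finite[OF radon_\<nu>] sets_\<nu>] by simp
    have "potential s 0 \<nu> x \<le> ennreal (1 / D) * ennreal D" for x
      unfolding \<nu>_def potential_density_const[OF sets_\<rho>] by (intro mult_left_mono pot_\<rho> s) simp
    then show "AE x in lborel. potential s 0 \<nu> x \<le> 1" using Dc by (simp add: mult.commute)
  qed
  have "emeasure \<nu> UNIV = ennreal (1 / D) * emeasure \<rho> UNIV"
    unfolding \<nu>_def by (rule emeasure_density_const) (simp add: sets_\<rho>)
  then have mass_\<nu>: "emeasure \<kappa> F = ennreal D * emeasure \<nu> UNIV"
    by (simp only: mult.assoc[symmetric] Dc mult_1 mass_\<rho>)
  show thesis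
  proof (rule that)
    show "radon_measure \<nu>" by (rule radon_\<nu>)
    show "msupp \<nu> \<subseteq> msupp \<mu>"
      using supp_\<rho> msupp_density[OF sets_\<rho>, of "\<lambda>_. ennreal (1 / D)"] unfolding \<nu>_def by simp
    show "esssup lborel (T \<nu>) \<le> 1" "esssup lborel (T_adj \<nu>) \<le> 1"
      using pot_\<nu> by (simp_all add: T_eq_potential T_adj_eq_potential)
    show "emeasure \<mu> K \<le> ennreal (2 * D) * emeasure \<nu> UNIV"
      using F(2) D unfolding mass_\<kappa> mass_\<nu> by (simp add: ennreal_mult mult.assoc)
  qed
qed

lemma emeasure_UNIV_eq_SUP_cball:
  fixes \<mu> :: "'a::real_normed_vector measure"
  assumes "sets \<mu> = sets borel"
  shows "emeasure \<mu> UNIV = (SUP n. emeasure \<mu> (cball 0 (real n)))"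
proof -
  have "(\<Union>n. cball 0 (real n)) = (UNIV :: 'a set)"
    by (auto intro: real_arch_simple)
  moreover have "(SUP n. emeasure \<mu> (cball 0 (real n))) = emeasure \<mu> (\<Union>n. cball 0 (real n))"
    by (rule SUP_emeasure_incseq) (auto simp: assms incseq_def)
  ultimately show ?thesis by simp
qed

lemma capacity_plus_le:
  fixes E :: "'n::finite spacetime set"
  shows "capacity_plus E \<le> ennreal (4 ^ (CARD('n) + 1)) * capacity_L2 E"
  unfolding capacity_plus_def
proof (rule Sup_least, clarify)
  fix \<mu> :: "'n spacetime measure"
  assume \<mu>: "radon_measure \<mu>" "msupp \<mu> \<subseteq> E" "esssup lborel (T \<mu>) \<le> 1" "esssup lborel (T_adj \<mu>) \<le> 1"
  define \<nu> where "\<nu> = density \<mu> (\<lambda>_. ennreal (1 / 4 ^ (CARD('n) + 1)))"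
  note \<nu> = capacity_L2_witness[OF \<mu>(1,3,4), folded \<nu>_def]
  have supp: "msupp \<nu> \<subseteq> E" using \<nu>(2) \<mu>(2) by blast
  have "outer_measure_of \<mu> E = emeasure \<mu> UNIV"
    using \<mu>(1,2) by (intro outer_measure_of_msupp) (simp_all add: radon_measure_def)
  also have "\<dots> = ennreal (4 ^ (CARD('n) + 1)) * emeasure \<nu> UNIV" by (rule \<nu>(5))
  also have "emeasure \<nu> UNIV = outer_measure_of \<nu> E"
    using \<nu>(1) supp by (intro outer_measure_of_msupp[symmetric]) (simp_all add: radon_measure_def)
  also have "outer_measure_of \<nu> E \<le> capacity_L2 E"
    unfolding capacity_L2_def using \<nu> supp by (intro Sup_upper) blast
  finally show "outer_measure_of \<mu> E \<le> ennreal (4 ^ (CARD('n) + 1)) * capacity_L2 E"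
    by (simp add: mult_left_mono)
qed

lemma capacity_L2_le:
  fixes E :: "'n::finite spacetime set"
  shows "capacity_L2 E \<le> ennreal (2 * (5 * 2 ^ (CARD('n) + 1) + 4 ^ CARD('n))) * capacity_plus E"
  unfolding capacity_L2_def
proof (rule Sup_least, clarify)
  fix \<mu> :: "'n spacetime measure"
  assume \<mu>: "radon_measure \<mu>" "msupp \<mu> \<subseteq> E" "has_growth \<mu>" "T_L2_bound \<mu> 1"
  let ?C = "ennreal (2 * (5 * 2 ^ (CARD('n) + 1) + 4 ^ CARD('n)))"
  have sets: "sets \<mu> = sets borel" using \<mu>(1) by (simp add: radon_measure_def)
  have "emeasure \<mu> (cball 0 (real n)) \<le> ?C * capacity_plus E" for n
  proof -
    obtain \<nu> where \<nu>: "radon_measure \<nu>" "msupp \<nu> \<subseteq> msupp \<mu>"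
      "esssup lborel (T \<nu>) \<le> 1" "esssup lborel (T_adj \<nu>) \<le> 1"
      "emeasure \<mu> (cball 0 (real n)) \<le> ?C * emeasure \<nu> UNIV"
      using capacity_plus_witness[OF \<mu>(1,3,4) compact_cball] by blast
    have supp: "msupp \<nu> \<subseteq> E" using \<nu>(2) \<mu>(2) by blast
    have "emeasure \<nu> UNIV = outer_measure_of \<nu> E"
      using \<nu>(1) supp by (intro outer_measure_of_msupp[symmetric]) (simp_all add: radon_measure_def)
    also have "\<dots> \<le> capacity_plus E"
      unfolding capacity_plus_def using \<nu> supp by (intro Sup_upper) blast
    finally show ?thesis using \<nu>(5) by (meson mult_left_mono order_trans zero_le)
  qed
  then show "outer_measure_of \<mu> E \<le> ?C * capacity_plus E"
    unfolding outer_measure_of_msupp[OF sets \<mu>(2)] emeasure_UNIV_eq_SUP_cball[OF sets]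
    by (intro SUP_least)
qed

theorem theorem4p3:
  shows "\<exists>C::real. C \<ge> 1 \<and>
    (\<forall>E :: 'n::finite spacetime set.
       ennreal (1 / C) * capacity_L2 E \<le> capacity_plus E \<and>
       capacity_plus E \<le> ennreal C * capacity_L2 E)"
proof -
  let ?A = "4 ^ (CARD('n) + 1) :: real"
  let ?B = "2 * (5 * 2 ^ (CARD('n) + 1) + 4 ^ CARD('n)) :: real"
  define C where "C = max ?A ?B"
  have "1 \<le> ?A" by (rule one_le_power) simp
  then have C: "C \<ge> 1" by (simp add: C_def)
  have "ennreal (1 / C) * capacity_L2 E \<le> capacity_plus E"
    and "capacity_plus E \<le> ennreal C * capacity_L2 E" for E :: "'n spacetime set"
  proof -
    have "capacity_L2 E \<le> ennreal C * capacity_plus E"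
      using capacity_L2_le[of E]
      by (rule order_trans) (intro mult_right_mono ennreal_leI, simp_all add: C_def)
    then have "ennreal (1 / C) * capacity_L2 E \<le> ennreal (1 / C) * (ennreal C * capacity_plus E)"
      by (intro mult_left_mono) auto
    also have "\<dots> = capacity_plus E"
      using C by (simp add: mult.assoc[symmetric] ennreal_mult[symmetric])
    finally show "ennreal (1 / C) * capacity_L2 E \<le> capacity_plus E" .
    show "capacity_plus E \<le> ennreal C * capacity_L2 E"
      using capacity_plus_le[of E]
      by (rule order_trans) (intro mult_right_mono ennreal_leI, simp_all add: C_def)
  qed
  then show ?thesis using C by blast
qed

end
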